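(* Let $\varepsilon\ge0$, $\delta\in[0,1]$ and $n\ge1$. Let $\Theta\sim P_\Theta$ be a random parameter in $\vartheta$, let $\{P_{X|\Theta}(\cdot|\theta):\theta\in\vartheta\}$ be a family of probability distributions on $\mathcal{X}$, and let $\ell:\vartheta\times\vartheta\to[0,\infty)$ be a loss function. In the non-interactive setting, the private Bayesian risk satisfies $$R_n^{\mathsf{Bayes}}(P_\Theta,\ell,\varepsilon,\delta)\ge\sup_{\zeta>0}\zeta\Big[1-\varphi_n(\varepsilon,\delta)\,I_{e^\varepsilon}(\Theta;X^n)-e^\varepsilon\mathcal{L}(\zeta)\Big],$$ where $\varphi_n(\varepsilon,\delta)=1-e^{-n\varepsilon}(1-\delta)^n$. Furthermore, for $n=1$, $$R_1^{\mathsf{Bayes}}(P_\Theta,\ell,\varepsilon,\delta)\ge\sup_{\zeta>0}\zeta\Big[1-\delta\,I_{e^\varepsilon}(\Theta;X)-e^\varepsilon\mathcal{L}(\zeta)\Big].$$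
   Context: A Markov kernel $\mathsf{K}:\mathcal{X}\to\mathcal{P}(\mathcal{Z})$ (from $\mathcal{X}$ to probability measures on $\mathcal{Z}$) is $(\varepsilon,\delta)$-LDP if $\sup_{x_1,x_2\in\mathcal{X}}\sup_{A\subset\mathcal{Z}}[\mathsf{K}(A|x_1)-e^\varepsilon\mathsf{K}(A|x_2)]\le\delta$ ($A$ measurable); $\mathcal{Q}_{\varepsilon,\delta}$ is the family of all such kernels. Setting: given $\Theta=\theta$, $X^n=(X_1,\dots,X_n)$ is i.i.d. from $P_{X|\Theta}(\cdot|\theta)$; in the non-interactive setting $Z^n=(Z_1,\dots,Z_n)$ is obtained by applying the same kernel $\mathsf{K}$ independently to each $X_i$ (i.e. $P_{Z^n|X^n}=\mathsf{K}^{\otimes n}$, with $\Theta\to X^n\to Z^n$ Markov). The private Bayesian risk is $R_n^{\mathsf{Bayes}}(P_\Theta,\ell,\varepsilon,\delta)=\inf_{\mathsf{K}\in\mathcal{Q}_{\varepsilon,\delta}}\inf_\Psi\mathbb{E}[\ell(\Theta,\Psi(Z^n))]$, with $\Psi:\mathcal{Z}^n\to\vartheta$ ranging over (measurable) estimators and expectation over $\Theta$ and $Z^n$. The small ball probability is $\mathcal{L}(\zeta)=\sup_{\theta\in\vartheta}\Pr(\ell(\Theta,\theta)\le\zeta)$. For $\gamma\ge1$, $\mathsf{E}_\gamma(\mu\|\nu)=\sup_A[\mu(A)-\gamma\nu(A)]$ over measurable $A$, and the $\mathsf{E}_\gamma$-information of $(U,V)\sim P_{UV}$ is $I_\gamma(U;V)=\mathsf{E}_\gamma(P_{UV}\|P_U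 P_V)$, where $P_UP_V$ is the product of the marginals. *)

theory Defs
  imports "HOL-Probability.Probability"
begin

text \<open>
  Markov kernels from \<open>X\<close> to \<open>Z\<close> are the elements of \<open>X \<rightarrow>\<^sub>M prob_algebra Z\<close>. The nested
  supremum is taken in the extended reals, where it exists unconditionally.
\<close>

definition LDP_kernels ::
  "'x measure \<Rightarrow> 'z measure \<Rightarrow> real \<Rightarrow> real \<Rightarrow> ('x \<Rightarrow> 'z measure) set" where
  "LDP_kernels X Z \<epsilon> \<delta> =
     {K \<in> X \<rightarrow>\<^sub>M prob_algebra Z.
        (SUP x1\<in>space X. SUP x2\<in>space X. SUP A\<in>sets Z.
           ereal (measure (K x1) A - exp \<epsilon> * measure (K x2) A)) \<le> ereal \<delta>}"

text \<open>For finite measures this is a supremum over a nonempty set of reals that is bounded above.\<close>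

definition E_gamma :: "real \<Rightarrow> 'a measure \<Rightarrow> 'a measure \<Rightarrow> real" where
  "E_gamma \<gamma> \<mu> \<nu> = (SUP A\<in>sets \<mu>. measure \<mu> A - \<gamma> * measure \<nu> A)"

text \<open>
  \<open>E_gamma_information \<gamma> A B J\<close> is the information between the two coordinates of a pair with joint
  law \<open>J\<close>, where \<open>J\<close> is a measure on the product of the measurable spaces \<open>A\<close> and \<open>B\<close>.
\<close>

definition E_gamma_information ::
  "real \<Rightarrow> 'a measure \<Rightarrow> 'b measure \<Rightarrow> ('a \<times> 'b) measure \<Rightarrow> real" where
  "E_gamma_information \<gamma> A B J = E_gamma \<gamma> J (distr J A fst \<Otimes>\<^sub>M distr J B snd)"

text \<open>The law of \<open>(a, b)\<close> when \<open>a\<close> has law \<open>\<mu>\<close> and \<open>b\<close>, given \<open>a\<close>, has law \<open>\<kappa> a\<close> on \<open>N\<close>.\<close>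

definition joint_law :: "'a measure \<Rightarrow> 'b measure \<Rightarrow> ('a \<Rightarrow> 'b measure) \<Rightarrow> ('a \<times> 'b) measure" where
  "joint_law \<mu> N \<kappa> =
     Giry_Monad.bind \<mu> (\<lambda>a. Giry_Monad.bind (\<kappa> a) (\<lambda>b. return (\<mu> \<Otimes>\<^sub>M N) (a, b)))"

text \<open>\<open>n\<close>-tuples are indexed by \<open>{..<n}\<close>.\<close>

abbreviation power_space :: "nat \<Rightarrow> 'a measure \<Rightarrow> (nat \<Rightarrow> 'a) measure" where
  "power_space n M \<equiv> Pi\<^sub>M {..<n} (\<lambda>_. M)"

definition power_kernel :: "nat \<Rightarrow> ('x \<Rightarrow> 'z measure) \<Rightarrow> (nat \<Rightarrow> 'x) \<Rightarrow> (nat \<Rightarrow> 'z) measure" where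
  "power_kernel n K x = Pi\<^sub>M {..<n} (\<lambda>i. K (x i))"

text \<open>The conditional laws of \<open>X\<^sup>n\<close> and of \<open>Z\<^sup>n\<close> given \<open>\<Theta> = \<theta>\<close>.\<close>

definition sample_law :: "nat \<Rightarrow> ('t \<Rightarrow> 'x measure) \<Rightarrow> 't \<Rightarrow> (nat \<Rightarrow> 'x) measure" where
  "sample_law n P \<theta> = power_space n (P \<theta>)"

definition private_law ::
  "nat \<Rightarrow> ('t \<Rightarrow> 'x measure) \<Rightarrow> ('x \<Rightarrow> 'z measure) \<Rightarrow> 't \<Rightarrow> (nat \<Rightarrow> 'z) measure" where
  "private_law n P K \<theta> = Giry_Monad.bind (sample_law n P \<theta>) (power_kernel n K)"

definition private_bayes_risk ::
  "nat \<Rightarrow> 't measure \<Rightarrow> 'x measure \<Rightarrow> ('t \<Rightarrow> 'x measure) \<Rightarrow> 'z measure \<Rightarrow> ('t \<Rightarrow> 't \<Rightarrow> real) \<Rightarrow>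
    real \<Rightarrow> real \<Rightarrow> ennreal" where
  "private_bayes_risk n T X P Z loss \<epsilon> \<delta> =
     (INF K\<in>LDP_kernels X Z \<epsilon> \<delta>. INF \<Psi>\<in>(power_space n Z \<rightarrow>\<^sub>M T).
        \<integral>\<^sup>+ (\<theta>, z). ennreal (loss \<theta> (\<Psi> z)) \<partial>joint_law T (power_space n Z) (private_law n P K))"

definition small_ball :: "'t measure \<Rightarrow> ('t \<Rightarrow> 't \<Rightarrow> real) \<Rightarrow> real \<Rightarrow> real" where
  "small_ball T loss \<zeta> = (SUP \<theta>\<in>space T. measure T {t \<in> space T. loss t \<theta> \<le> \<zeta>})"

definition phi :: "nat \<Rightarrow> real \<Rightarrow> real \<Rightarrow> real" where
  "phi n \<epsilon> \<delta> = 1 - exp (- (real n * \<epsilon>)) * (1 - \<delta>) ^ n"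

end

theory Submission
  imports Defs
begin

text \<open>
  By Markov's inequality it suffices to bound the probability of the event
  \<open>A = {(\<theta>, z). \<ell>(\<theta>, \<Psi>(z)) \<le> \<zeta>}\<close> under the joint law of \<open>(\<Theta>, Z\<^sup>n)\<close>. Under the product of the
  marginals \<open>A\<close> has probability at most \<open>L(\<zeta>)\<close>, so the bound follows from the contraction inequality
  \<open>I\<^sub>\<gamma>(\<Theta>; Z) \<le> \<eta> I\<^sub>\<gamma>(\<Theta>; X)\<close> for any channel with \<open>K(B|x) \<le> \<eta> + \<gamma> K(B|y)\<close> for all \<open>x\<close>, \<open>y\<close>, \<open>B\<close>.
  For one use of the mechanism \<open>\<eta> = \<delta>\<close>. For \<open>n\<close> uses, any two output laws of a single use overlap in
  mass at least \<open>c = e\<^sup>-\<^sup>\<epsilon>(1 - \<delta>)\<close>, overlaps of product measures multiply, and so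
  \<open>\<eta> = 1 - c\<^sup>n = \<phi>\<^sub>n(\<epsilon>, \<delta>)\<close> works already with \<open>1\<close> in place of \<open>\<gamma> = e\<^sup>\<epsilon>\<close>.
\<close>

section \<open>Comparing integrals of bounded functions under two measures\<close>

text \<open>Cutting both measures down by the density \<open>indicator S\<close> turns the
  comparison on subsets of \<open>S\<close> into an inequality of measures. This is how each half of
  a Hahn decomposition is exploited below.\<close>

lemma set_nn_integral_mono_measure:
  fixes f :: "'a \<Rightarrow> ennreal"
  assumes sets: "sets N = sets M" and [measurable]: "S \<in> sets M" "f \<in> borel_measurable M"
    and le: "\<And>A. A \<in> sets M \<Longrightarrow> A \<subseteq> S \<Longrightarrow> emeasure M A \<le> emeasure N A"
  shows "(\<integral>\<^sup>+x\<in>S. f x \<partial>M) \<le> (\<integral>\<^sup>+x\<in>S. f x \<partial>N)"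
proof -
  have N[measurable]: "S \<in> sets N" "f \<in> borel_measurable N"
    using assms by (simp_all cong: measurable_cong_sets)
  have "density M (indicator S) \<le> density N (indicator S)"
    using sets le[of "_ \<inter> S"]
    by (subst le_measure) (auto simp: emeasure_density simp flip: indicator_inter_arith ac_simps)
  then have "(\<integral>\<^sup>+x. f x \<partial>density M (indicator S)) \<le> (\<integral>\<^sup>+x. f x \<partial>density N (indicator S))"
    using sets by (intro nn_integral_mono_measure) auto
  then show ?thesis
    by (simp add: nn_integral_density mult.commute)
qed

lemma nn_integral_set_split:
  fixes f :: "'a \<Rightarrow> ennreal"
  assumes [measurable]: "S \<in> sets M" "f \<in> borel_measurable M"
  shows "(\<integral>\<^sup>+x. f x \<partial>M) = (\<integral>\<^sup>+x\<in>S. f x \<partial>M) + (\<integral>\<^sup>+x\<in>space M - S. f x \<partial>M)"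
  by (subst nn_integral_add[symmetric]) (auto intro!: nn_integral_cong split: split_indicator)

lemma finite_measure_scale_measure:
  "finite_measure M \<Longrightarrow> finite_measure (scale_measure (ennreal r) M)"
  by (rule finite_measureI) (simp add: space_scale_measure ennreal_mult_eq_top_iff finite_measure.emeasure_finite)

text \<open>\<open>E_gamma\<close> is a supremum of reals, so an upper bound has to be supplied: no
  difference exceeds 1, because \<open>J\<close> has mass 1 and \<gamma> is nonnegative.\<close>

lemma measure_diff_le_E_gamma:
  assumes "prob_space J" "prob_space N" "0 \<le> \<gamma>" "A \<in> sets J"
  shows "measure J A - \<gamma> * measure N A \<le> E_gamma \<gamma> J N"
proof -
  have "measure J B - \<gamma> * measure N B \<le> 1" for B
    using prob_space.prob_le_1[OF assms(1), of B] assms(3)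
    by (smt (verit) mult_nonneg_nonneg measure_nonneg)
  then show ?thesis
    unfolding E_gamma_def using assms(4) by (intro cSUP_upper bdd_aboveI2)
qed

text \<open>Take a Hahn decomposition of \<open>J\<close> against \<gamma> times \<open>N\<close>.
  Where \<open>J\<close> is the smaller measure nothing is lost. On the other part \<open>Y\<close>
  the excess of \<open>J\<close> has mass at most \<open>E_gamma \<gamma> J N\<close>, and
  \<open>g\<close> is at most \<eta> there.\<close>

lemma nn_integral_le_E_gamma:
  fixes g :: "'a \<Rightarrow> ennreal" and \<gamma> \<eta> :: real
  assumes J: "prob_space J" and N: "prob_space N" and sets: "sets N = sets J"
    and \<gamma>: "0 \<le> \<gamma>" and g[measurable]: "g \<in> borel_measurable J"
    and le: "\<And>x. x \<in> space J \<Longrightarrow> g x \<le> ennreal \<eta>"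
  shows "(\<integral>\<^sup>+x. g x \<partial>J) \<le> \<gamma> * (\<integral>\<^sup>+x. g x \<partial>N) + \<eta> * ennreal (E_gamma \<gamma> J N)"
proof -
  interpret J: prob_space J by fact
  interpret N: prob_space N by fact
  let ?N = "scale_measure \<gamma> N"
  have fN: "finite_measure ?N"
    using N.finite_measure_axioms by (rule finite_measure_scale_measure)
  interpret N': finite_measure ?N by fact
  have sets': "sets ?N = sets J" using sets by simp
  note mc = measurable_cong_sets[OF sets' refl, of borel]
  from finite_unsigned_Hahn_decomposition[OF J.finite_measure_axioms fN sets']
  obtain Y where Y[measurable]: "Y \<in> sets J"
    and Y1: "\<And>A. A \<in> sets J \<Longrightarrow> A \<subseteq> Y \<Longrightarrow> emeasure ?N A \<le> emeasure J A"
    and Y2: "\<And>A. A \<in> sets J \<Longrightarrow> A \<inter> Y = {} \<Longrightarrow> emeasure J A \<le> emeasure ?N A"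
    by auto
  have YN[measurable]: "Y \<in> sets ?N" "g \<in> borel_measurable ?N"
    using Y g by (simp_all add: sets mc)
  have sp: "space ?N = space J" by (rule sets_eq_imp_space_eq[OF sets'])
  \<comment> \<open>The excess measure is not formed, since measures cannot be subtracted here.
    Instead \<open>g\<close> is traded for its complement \<open>\<eta> - g\<close>, for which the
    comparison on \<open>Y\<close> gives an inequality in the opposite direction.\<close>
  have split: "(\<integral>\<^sup>+x\<in>Y. g x \<partial>M) + (\<integral>\<^sup>+x\<in>Y. (\<eta> - g x) \<partial>M) = \<eta> * emeasure M Y"
    if [measurable_cong]: "sets M = sets J" for M
  proof -
    have [simp]: "space M = space J" by (rule sets_eq_imp_space_eq[OF that])
    have "(\<integral>\<^sup>+x\<in>Y. g x \<partial>M) + (\<integral>\<^sup>+x\<in>Y. (\<eta> - g x) \<partial>M) = (\<integral>\<^sup>+x. ennreal \<eta> * indicator Y x \<partial>M)"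
      using le by (subst nn_integral_add[symmetric])
        (auto intro!: nn_integral_cong simp: add_diff_inverse_ennreal split: split_indicator)
    then show ?thesis using that by (simp add: nn_integral_cmult_indicator)
  qed
  have E: "emeasure J Y \<le> emeasure ?N Y + ennreal (E_gamma \<gamma> J N)"
  proof -
    have "measure J Y \<le> \<gamma> * measure N Y + E_gamma \<gamma> J N"
      using measure_diff_le_E_gamma[OF J N \<gamma> Y] by simp
    then have "ennreal (measure J Y) \<le> ennreal (\<gamma> * measure N Y) + ennreal (E_gamma \<gamma> J N)"
      by (smt (verit) ennreal_leI ennreal_plus_if)
    then show ?thesis
      using \<gamma> by (simp add: J.emeasure_eq_measure N.emeasure_eq_measure ennreal_mult)
  qed
  \<comment> \<open>Finiteness is what permits cancelling this integral from both sides in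
    \<open>ennreal\<close>.\<close>
  have fin: "(\<integral>\<^sup>+x\<in>Y. (\<eta> - g x) \<partial>?N) \<noteq> top"
    using split[OF sets'] N'.emeasure_finite[of Y]
    by (metis ennreal_add_eq_top ennreal_mult_eq_top_iff ennreal_neq_top)
  have "(\<integral>\<^sup>+x\<in>Y. (\<eta> - g x) \<partial>?N) + (\<integral>\<^sup>+x\<in>Y. g x \<partial>J)
      \<le> (\<integral>\<^sup>+x\<in>Y. (\<eta> - g x) \<partial>J) + (\<integral>\<^sup>+x\<in>Y. g x \<partial>J)"
    using Y1 sets' by (intro add_right_mono set_nn_integral_mono_measure) (auto simp: mc)
  also have "\<dots> = \<eta> * emeasure J Y"
    using split[OF refl] by (simp add: add.commute)
  also have "\<dots> \<le> \<eta> * emeasure ?N Y + \<eta> * ennreal (E_gamma \<gamma> J N)"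
    using E by (metis distrib_left mult_left_mono zero_le)
  also have "\<dots> = (\<integral>\<^sup>+x\<in>Y. (\<eta> - g x) \<partial>?N) + ((\<integral>\<^sup>+x\<in>Y. g x \<partial>?N) + \<eta> * ennreal (E_gamma \<gamma> J N))"
    using split[OF sets'] by (simp add: ac_simps)
  finally have 1: "(\<integral>\<^sup>+x\<in>Y. g x \<partial>J) \<le> (\<integral>\<^sup>+x\<in>Y. g x \<partial>?N) + \<eta> * ennreal (E_gamma \<gamma> J N)"
    using fin by (simp add: ennreal_add_left_cancel_le)
  have 2: "(\<integral>\<^sup>+x\<in>space J - Y. g x \<partial>J) \<le> (\<integral>\<^sup>+x\<in>space J - Y. g x \<partial>?N)"
    using Y2 sets' by (intro set_nn_integral_mono_measure) auto
  have "(\<integral>\<^sup>+x. g x \<partial>J) \<le> (\<integral>\<^sup>+x. g x \<partial>?N) + \<eta> * ennreal (E_gamma \<gamma> J N)"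
    unfolding nn_integral_set_split[OF Y g] nn_integral_set_split[OF YN]
    using add_mono[OF 1 2] by (simp add: ac_simps sp)
  also have "(\<integral>\<^sup>+x. g x \<partial>?N) = \<gamma> * (\<integral>\<^sup>+x. g x \<partial>N)"
    using YN by (intro nn_integral_scale_measure) (simp cong: measurable_cong_sets)
  finally show ?thesis .
qed

section \<open>Overlap of two measures and of their products\<close>

text \<open>
  Stating the overlap with functions \<open>h\<close>, \<open>k\<close> instead of a set and its complement is what lets it
  pass to products one coordinate at a time.
\<close>

lemma overlap_nn_integral:
  fixes h k :: "'a \<Rightarrow> ennreal"
  assumes M: "finite_measure M" and N: "finite_measure N" and sets: "sets N = sets M"
    and [measurable]: "h \<in> borel_measurable M" "k \<in> borel_measurable M"
    and c: "\<And>A. A \<in> sets M \<Longrightarrow> c \<le> emeasure M A + emeasure N (space M - A)"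
    and w: "\<And>x. x \<in> space M \<Longrightarrow> w \<le> h x + k x"
  shows "c * w \<le> (\<integral>\<^sup>+x. h x \<partial>M) + (\<integral>\<^sup>+x. k x \<partial>N)"
proof -
  from finite_unsigned_Hahn_decomposition[OF M N sets]
  obtain Y where Y[measurable]: "Y \<in> sets M"
    and Y1: "\<And>A. A \<in> sets M \<Longrightarrow> A \<subseteq> Y \<Longrightarrow> emeasure N A \<le> emeasure M A"
    and Y2: "\<And>A. A \<in> sets M \<Longrightarrow> A \<inter> Y = {} \<Longrightarrow> emeasure M A \<le> emeasure N A"
    by auto
  note [measurable_cong] = sets
  have sp: "space N = space M" by (rule sets_eq_imp_space_eq[OF sets])
  \<comment> \<open>On \<open>Y\<close> the smaller measure is \<open>N\<close>, off
    \<open>Y\<close> it is \<open>M\<close>. Assumption \<open>c\<close> at the complement of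
    \<open>Y\<close> therefore says that the minimum of the two measures has mass at least
    \<open>c\<close>, and integrating \<open>w \<le> h + k\<close> against this minimum gives the
    claim.\<close>
  have "c * w \<le> (emeasure M (space M - Y) + emeasure N (space M - (space M - Y))) * w"
    by (intro mult_right_mono c) auto
  also have "\<dots> = (\<integral>\<^sup>+x\<in>space M - Y. w \<partial>M) + (\<integral>\<^sup>+x\<in>Y. w \<partial>N)"
    using sets.sets_into_space[OF Y] Y sets
    by (simp add: double_diff nn_integral_cmult_indicator distrib_left distrib_right mult.commute sp)
  also have "\<dots> \<le> (\<integral>\<^sup>+x\<in>space M - Y. (h x + k x) \<partial>M) + (\<integral>\<^sup>+x\<in>Y. (h x + k x) \<partial>N)"
    using w sets.sets_into_space[OF Y] by (intro add_mono nn_integral_mono) (auto split: split_indicator simp: sp)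
  also have "\<dots> = ((\<integral>\<^sup>+x\<in>Y. h x \<partial>N) + (\<integral>\<^sup>+x\<in>space M - Y. h x \<partial>M)) +
                 ((\<integral>\<^sup>+x\<in>Y. k x \<partial>N) + (\<integral>\<^sup>+x\<in>space M - Y. k x \<partial>M))"
  proof -
    have "(\<integral>\<^sup>+x\<in>space M - Y. (h x + k x) \<partial>M) =
        (\<integral>\<^sup>+x\<in>space M - Y. h x \<partial>M) + (\<integral>\<^sup>+x\<in>space M - Y. k x \<partial>M)"
      by (subst nn_integral_add[symmetric]) (auto simp: distrib_right)
    moreover have "(\<integral>\<^sup>+x\<in>Y. (h x + k x) \<partial>N) = (\<integral>\<^sup>+x\<in>Y. h x \<partial>N) + (\<integral>\<^sup>+x\<in>Y. k x \<partial>N)"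
      by (subst nn_integral_add[symmetric]) (auto simp: distrib_right)
    ultimately show ?thesis by (simp only: ac_simps)
  qed
  also have "\<dots> \<le> ((\<integral>\<^sup>+x\<in>Y. h x \<partial>M) + (\<integral>\<^sup>+x\<in>space M - Y. h x \<partial>M)) +
                 ((\<integral>\<^sup>+x\<in>Y. k x \<partial>N) + (\<integral>\<^sup>+x\<in>space M - Y. k x \<partial>N))"
    using Y1 Y2 by (intro add_mono order_refl set_nn_integral_mono_measure) (auto simp: sets)
  also have "\<dots> = (\<integral>\<^sup>+x. h x \<partial>M) + (\<integral>\<^sup>+x. k x \<partial>N)"
    by (simp add: nn_integral_set_split[of Y M h] nn_integral_set_split[of Y N k] sp)
  finally show ?thesis .
qed

text \<open>Integrate out one coordinate at a time. With the other coordinates fixed,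
  \<open>overlap_nn_integral\<close> bounds the sum of the partial integrals of \<open>h\<close> and
  \<open>k\<close> below by \<open>c * w\<close>, so these satisfy the hypothesis on the smaller
  index set with \<open>c * w\<close> in place of \<open>w\<close>. Hence the induction generalizes
  over \<open>h\<close>, \<open>k\<close> and \<open>w\<close>.\<close>

lemma overlap_nn_integral_PiM:
  fixes h k :: "('i \<Rightarrow> 'a) \<Rightarrow> ennreal"
  assumes "finite I" and M: "\<And>i. prob_space (M i)" and N: "\<And>i. prob_space (N i)"
    and sets: "\<And>i. sets (N i) = sets (M i)"
    and c: "\<And>i A. A \<in> sets (M i) \<Longrightarrow> c \<le> emeasure (M i) A + emeasure (N i) (space (M i) - A)"
    and "h \<in> borel_measurable (PiM I M)" "k \<in> borel_measurable (PiM I M)"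
    and w: "\<And>x. x \<in> space (PiM I M) \<Longrightarrow> w \<le> h x + k x"
  shows "c ^ card I * w \<le> (\<integral>\<^sup>+x. h x \<partial>PiM I M) + (\<integral>\<^sup>+x. k x \<partial>PiM I N)"
  using \<open>finite I\<close> assms(6-)
proof (induction I arbitrary: h k w)
  case empty
  then show ?case by (simp add: PiM_empty nn_integral_count_space_finite)
next
  case (insert i I)
  interpret M: product_prob_space M by (rule product_prob_spaceI[OF M])
  interpret N: product_prob_space N by (rule product_prob_spaceI[OF N])
  note [measurable_cong] = sets
  note [measurable] = insert.prems(1,2)
  have sI[measurable_cong]: "sets (PiM J N) = sets (PiM J M)" for J
    by (intro sets_PiM_cong sets refl)
  let ?h = "\<lambda>x. \<integral>\<^sup>+y. h (x(i := y)) \<partial>M i" and ?k = "\<lambda>x. \<integral>\<^sup>+y. k (x(i := y)) \<partial>N i"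
  have k: "k \<in> borel_measurable (PiM (insert i I) N)" by measurable
  have "c ^ card (insert i I) * w = c ^ card I * (c * w)"
    using insert by (simp add: ac_simps)
  also have "\<dots> \<le> (\<integral>\<^sup>+x. ?h x \<partial>PiM I M) + (\<integral>\<^sup>+x. ?k x \<partial>PiM I N)"
  proof (rule insert.IH)
    show "?h \<in> borel_measurable (PiM I M)" "?k \<in> borel_measurable (PiM I M)"
      by measurable
    show "c * w \<le> ?h x + ?k x" if [measurable]: "x \<in> space (PiM I M)" for x
      using that
      by (intro overlap_nn_integral M.M.finite_measure_axioms N.M.finite_measure_axioms sets c
          insert.prems(3)) (auto simp: space_PiM PiE_iff extensional_def split: if_splits)
  qed
  also have "\<dots> = (\<integral>\<^sup>+x. h x \<partial>PiM (insert i I) M) + (\<integral>\<^sup>+x. k x \<partial>PiM (insert i I) N)"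
    using insert k by (simp add: M.product_nn_integral_insert N.product_nn_integral_insert)
  finally show ?case .
qed


section \<open>Measurability of product kernels and joint laws\<close>

text \<open>Finite rectangles form an intersection-stable generator, and on them the product measure
  is a finite product of measurable functions.\<close>

lemma measurable_PiM_prob_algebra:
  assumes I: "finite I" and \<kappa>: "\<And>i. \<kappa> i \<in> M \<rightarrow>\<^sub>M prob_algebra (N i)"
  shows "(\<lambda>x. PiM I (\<lambda>i. \<kappa> i x)) \<in> M \<rightarrow>\<^sub>M prob_algebra (PiM I N)"
proof (rule measurable_prob_algebra_generated[OF sets_PiM Int_stable_prod_algebra])
  show "prod_algebra I N \<subseteq> Pow (\<Pi>\<^sub>E i\<in>I. space (N i))"
    by (rule prod_algebra_sets_into_space)
next
  fix x assume "x \<in> space M"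
  then have \<kappa>x: "prob_space (\<kappa> i x)" "sets (\<kappa> i x) = sets (N i)" for i
    using measurable_space[OF \<kappa>[of i]] by (auto simp: space_prob_algebra)
  show "prob_space (PiM I (\<lambda>i. \<kappa> i x))"
    by (intro prob_space_PiM \<kappa>x)
  show "sets (PiM I (\<lambda>i. \<kappa> i x)) = sets (PiM I N)"
    by (intro sets_PiM_cong \<kappa>x refl)
next
  fix A assume "A \<in> prod_algebra I N"
  then obtain B where A: "A = (\<Pi>\<^sub>E i\<in>I. B i)" and B: "\<And>i. i \<in> I \<Longrightarrow> B i \<in> sets (N i)"
    by (auto simp: prod_algebra_eq_finite[OF I])
  have "emeasure (PiM I (\<lambda>i. \<kappa> i x)) A = (\<Prod>i\<in>I. emeasure (\<kappa> i x) (B i))" if "x \<in> space M" for x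
  proof -
    have \<kappa>x: "prob_space (\<kappa> i x)" "sets (\<kappa> i x) = sets (N i)" for i
      using measurable_space[OF \<kappa>[of i] that] by (auto simp: space_prob_algebra)
    interpret product_prob_space "\<lambda>i. \<kappa> i x" by (rule product_prob_spaceI[OF \<kappa>x(1)])
    show ?thesis unfolding A using B by (intro emeasure_PiM I) (simp add: \<kappa>x(2))
  qed
  moreover have "(\<lambda>x. \<Prod>i\<in>I. emeasure (\<kappa> i x) (B i)) \<in> borel_measurable M"
    using B measurable_prob_algebraD[OF \<kappa>]
    by (intro borel_measurable_prod_ennreal measurable_emeasure_kernel)
  ultimately show "(\<lambda>x. emeasure (PiM I (\<lambda>i. \<kappa> i x)) A) \<in> borel_measurable M"
    by (simp cong: measurable_cong)
qed

text \<open>Outside \<open>{..<n}\<close> a tuple is \<open>undefined\<close>, so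
  \<open>K (x i)\<close> need not be a probability measure there, while the product lemmas ask for
  one at every index. Sending those indices to coordinate 0, which exists as
  \<open>1 \<le> n\<close>, leaves the product unchanged.\<close>

lemma power_kernel_eq:
  assumes "1 \<le> n"
  shows "power_kernel n K x = PiM {..<n} (\<lambda>i. K (x (if i < n then i else 0)))"
  unfolding power_kernel_def by (intro PiM_cong) auto

lemma measurable_power_kernel:
  assumes "1 \<le> n" "K \<in> X \<rightarrow>\<^sub>M prob_algebra Z"
  shows "power_kernel n K \<in> power_space n X \<rightarrow>\<^sub>M prob_algebra (power_space n Z)"
  unfolding power_kernel_eq[OF assms(1)]
  using assms by (intro measurable_PiM_prob_algebra measurable_compose[OF _ assms(2)]
      measurable_component_singleton) auto

lemma measurable_sample_law:
  assumes "P \<in> T \<rightarrow>\<^sub>M prob_algebra X"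
  shows "sample_law n P \<in> T \<rightarrow>\<^sub>M prob_algebra (power_space n X)"
  unfolding sample_law_def using assms by (intro measurable_PiM_prob_algebra) auto

lemma measurable_joint_kernel:
  assumes \<kappa>: "\<kappa> \<in> T \<rightarrow>\<^sub>M prob_algebra M"
  shows "(\<lambda>a. Giry_Monad.bind (\<kappa> a) (\<lambda>b. return (T \<Otimes>\<^sub>M M) (a, b))) \<in> T \<rightarrow>\<^sub>M prob_algebra (T \<Otimes>\<^sub>M M)"
  by (rule measurable_bind_prob_space2[OF \<kappa>]) measurable

lemma joint_law_in_prob_algebra:
  assumes T: "prob_space T" and \<kappa>: "\<kappa> \<in> T \<rightarrow>\<^sub>M prob_algebra M"
  shows "joint_law T M \<kappa> \<in> space (prob_algebra (T \<Otimes>\<^sub>M M))"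
  unfolding joint_law_def
  using measurable_space[OF measurable_bind_prob_space[OF measurable_ident measurable_joint_kernel[OF \<kappa>]], of T] T
  by (simp add: space_prob_algebra id_def)

lemma nn_integral_joint_law:
  assumes \<kappa>: "\<kappa> \<in> T \<rightarrow>\<^sub>M prob_algebra M"
    and h[measurable]: "h \<in> borel_measurable (T \<Otimes>\<^sub>M M)"
  shows "(\<integral>\<^sup>+p. h p \<partial>joint_law T M \<kappa>) = (\<integral>\<^sup>+a. \<integral>\<^sup>+b. h (a, b) \<partial>\<kappa> a \<partial>T)"
  unfolding joint_law_def
proof (subst nn_integral_bind[OF h measurable_prob_algebraD[OF measurable_joint_kernel[OF \<kappa>]]],
    rule nn_integral_cong)
  fix a assume a[measurable]: "a \<in> space T"
  have [measurable_cong]: "sets (\<kappa> a) = sets M"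
    using measurable_space[OF \<kappa> a] by (simp add: space_prob_algebra)
  have "(\<integral>\<^sup>+p. h p \<partial>Giry_Monad.bind (\<kappa> a) (\<lambda>b. return (T \<Otimes>\<^sub>M M) (a, b))) =
      (\<integral>\<^sup>+b. \<integral>\<^sup>+p. h p \<partial>return (T \<Otimes>\<^sub>M M) (a, b) \<partial>\<kappa> a)"
    by (rule nn_integral_bind[OF h]) measurable
  also have "\<dots> = (\<integral>\<^sup>+b. h (a, b) \<partial>\<kappa> a)"
    using a by (intro nn_integral_cong nn_integral_return h)
      (auto simp: space_pair_measure sets_eq_imp_space_eq[OF \<open>sets (\<kappa> a) = sets M\<close>])
  finally show "(\<integral>\<^sup>+p. h p \<partial>Giry_Monad.bind (\<kappa> a) (\<lambda>b. return (T \<Otimes>\<^sub>M M) (a, b))) = (\<integral>\<^sup>+b. h (a, b) \<partial>\<kappa> a)" .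
qed

lemma distr_joint_law_fst:
  assumes T: "prob_space T" and \<kappa>: "\<kappa> \<in> T \<rightarrow>\<^sub>M prob_algebra M"
  shows "distr (joint_law T M \<kappa>) T fst = T"
proof (rule measure_eqI)
  fix A assume "A \<in> sets (distr (joint_law T M \<kappa>) T fst)"
  then have A[measurable]: "A \<in> sets T" by simp
  have J[measurable_cong]: "sets (joint_law T M \<kappa>) = sets (T \<Otimes>\<^sub>M M)"
    using joint_law_in_prob_algebra[OF T \<kappa>] by (simp add: space_prob_algebra)
  have "emeasure (distr (joint_law T M \<kappa>) T fst) A = (\<integral>\<^sup>+p. indicator A p \<partial>distr (joint_law T M \<kappa>) T fst)"
    by simp
  also have "\<dots> = (\<integral>\<^sup>+p. indicator A (fst p) \<partial>joint_law T M \<kappa>)"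
    by (rule nn_integral_distr) measurable
  also have "\<dots> = (\<integral>\<^sup>+a. \<integral>\<^sup>+b. indicator A a \<partial>\<kappa> a \<partial>T)"
    by (subst nn_integral_joint_law[OF \<kappa>]) simp_all
  also have "\<dots> = (\<integral>\<^sup>+a. indicator A a \<partial>T)"
    using measurable_space[OF \<kappa>]
    by (intro nn_integral_cong) (simp add: space_prob_algebra prob_space.emeasure_space_1)
  finally show "emeasure (distr (joint_law T M \<kappa>) T fst) A = emeasure T A"
    by simp
qed simp

section \<open>Contraction of the information through a channel\<close>

text \<open>Up to the factor \<gamma>, \<open>f (\<theta>, _)\<close> varies by at most \<eta>.
  Removing a lower envelope that depends on \<theta> only leaves a function with values in
  [0, \<eta>], to which \<open>nn_integral_le_E_gamma\<close> applies. \<open>J\<close> is not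
  assumed absolutely continuous with respect to \<open>T \<Otimes>\<^sub>M Q\<close>, so the upper
  bound on \<open>f\<close> must hold everywhere, whereas the lower one may fail on a null set of
  the product.\<close>

lemma nn_integral_contraction:
  fixes f :: "'a \<times> 'b \<Rightarrow> ennreal" and \<gamma> \<eta> :: real
  assumes T: "prob_space T" and Q: "prob_space Q" and J: "prob_space J"
    and sets[measurable_cong]: "sets J = sets (T \<Otimes>\<^sub>M Q)" and marg: "distr J T fst = T"
    and \<gamma>: "1 \<le> \<gamma>" and \<eta>: "0 \<le> \<eta>"
    and f[measurable]: "f \<in> borel_measurable (T \<Otimes>\<^sub>M Q)"
    and le: "\<And>\<theta> x y. \<theta> \<in> space T \<Longrightarrow> x \<in> space Q \<Longrightarrow> y \<in> space Q \<Longrightarrow> f (\<theta>, x) \<le> \<eta> + \<gamma> * f (\<theta>, y)"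
  shows "(\<integral>\<^sup>+p. f p \<partial>J) \<le> \<gamma> * (\<integral>\<^sup>+p. f p \<partial>(T \<Otimes>\<^sub>M Q)) + \<eta> * ennreal (E_gamma \<gamma> J (T \<Otimes>\<^sub>M Q))"
proof -
  interpret T: prob_space T by fact
  interpret Q: prob_space Q by fact
  interpret J: prob_space J by fact
  interpret TQ: pair_prob_space T Q ..
  have spJ: "space J = space T \<times> space Q"
    using sets_eq_imp_space_eq[OF sets] by (simp add: space_pair_measure)
  \<comment> \<open>The essential infimum of \<open>f (\<theta>, _)\<close> under \<open>Q\<close>; unlike the infimum it is measurable in \<open>\<theta>\<close>.\<close>
  define m :: "'a \<Rightarrow> ennreal" where
    "m \<theta> = (SUP q::rat. if emeasure Q {x\<in>space Q. f (\<theta>, x) < real_of_rat q} = 0 then ennreal (real_of_rat q) else 0)" for \<theta>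
  have m[measurable]: "m \<in> borel_measurable T"
    unfolding m_def by measurable
  have m_le: "AE x in Q. m \<theta> \<le> f (\<theta>, x)" if [measurable]: "\<theta> \<in> space T" for \<theta>
  proof -
    have "AE x in Q. (if emeasure Q {x\<in>space Q. f (\<theta>, x) < real_of_rat q} = 0
        then ennreal (real_of_rat q) else 0) \<le> f (\<theta>, x)" for q
    proof (cases "emeasure Q {x\<in>space Q. f (\<theta>, x) < real_of_rat q} = 0")
      case True
      then have "AE x in Q. \<not> f (\<theta>, x) < real_of_rat q"
        by (intro AE_I[OF _ True]) auto
      then show ?thesis by (auto simp: not_less)
    qed simp
    then have "AE x in Q. \<forall>q. (if emeasure Q {x\<in>space Q. f (\<theta>, x) < real_of_rat q} = 0
        then ennreal (real_of_rat q) else 0) \<le> f (\<theta>, x)"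
      by (subst AE_all_countable) auto
    then show ?thesis
      unfolding m_def by eventually_elim (blast intro: SUP_least)
  qed
  have le_m: "f (\<theta>, x) \<le> \<eta> + \<gamma> * m \<theta>" if \<theta>: "\<theta> \<in> space T" and x: "x \<in> space Q" for \<theta> x
  proof -
    \<comment> \<open>Solving hypothesis \<open>le\<close> for its right-hand value shows that
      \<open>y\<close> is a lower bound of \<open>f (\<theta>, _)\<close> on all of
      \<open>space Q\<close>. Each rational below \<open>y\<close> thus has an empty sublevel set
      and is counted in the supremum defining \<open>m \<theta>\<close>.\<close>
    define y where "y = (f (\<theta>, x) - \<eta>) / ennreal \<gamma>"
    have y: "y \<le> f (\<theta>, x')" if "x' \<in> space Q" for x'
      unfolding y_def using le[OF \<theta> x that] \<gamma>
      by (intro divide_le_posI_ennreal) (auto simp: ennreal_minus_le_iff)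
    have "y \<le> m \<theta>"
    proof (rule ccontr)
      assume "\<not> y \<le> m \<theta>"
      then obtain q :: rat where q: "m \<theta> < real_of_rat q" "real_of_rat q < y"
        using ennreal_rat_dense[of "m \<theta>" y] by (auto simp: not_le)
      have "{x\<in>space Q. f (\<theta>, x) < real_of_rat q} = {}"
        using y less_le_trans[OF q(2)] by (auto dest: order.asym)
      then have "emeasure Q {x\<in>space Q. f (\<theta>, x) < real_of_rat q} = 0"
        by (simp only: emeasure_empty)
      then have "ennreal (real_of_rat q) \<le> m \<theta>"
        unfolding m_def by (intro SUP_upper2[of q]) auto
      with q(1) show False by simp
    qed
    have "f (\<theta>, x) \<le> \<eta> + (f (\<theta>, x) - \<eta>)"
      using linear[of "ennreal \<eta>" "f (\<theta>, x)"] by (auto simp: add_diff_inverse_ennreal intro: add_increasing2)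
    also have "f (\<theta>, x) - \<eta> = \<gamma> * y"
      unfolding y_def using \<gamma> by (simp add: ennreal_times_divide mult.commute[of "ennreal \<gamma>"] ennreal_mult_divide_eq)
    also have "\<eta> + \<gamma> * y \<le> \<eta> + \<gamma> * m \<theta>"
      using \<open>y \<le> m \<theta>\<close> by (intro add_left_mono mult_left_mono) auto
    finally show ?thesis .
  qed
  \<comment> \<open>\<open>f \<le> g + \<gamma> m\<close> everywhere and \<open>g + m \<le> f\<close> almost everywhere under \<open>T \<Otimes>\<^sub>M Q\<close>; the contributions of
    \<open>m\<close> cancel because both measures have first marginal \<open>T\<close>.\<close>
  define g where "g p = min (f p - m (fst p)) (ennreal \<eta>)" for p
  have g[measurable]: "g \<in> borel_measurable (T \<Otimes>\<^sub>M Q)"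
    unfolding g_def by measurable
  have f_le: "f p \<le> g p + \<gamma> * m (fst p)" if "p \<in> space J" for p
  proof (cases "f p - m (fst p) \<le> \<eta>")
    case True
    have "f p \<le> (f p - m (fst p)) + m (fst p)"
      by (metis diff_add_cancel_ennreal le_cases add.commute add_increasing zero_le)
    also have "\<dots> \<le> g p + \<gamma> * m (fst p)"
      using True \<gamma> mult_right_mono[of 1 "ennreal \<gamma>" "m (fst p)"]
      by (intro add_mono) (auto simp: g_def)
    finally show ?thesis .
  next
    \<comment> \<open>The truncation is active here: \<open>g p\<close> equals \<eta>, and the claim
      is \<open>le_m\<close>.\<close>
    case False
    then show ?thesis
      using le_m[of "fst p" "snd p"] that by (auto simp: g_def spJ min_def)
  qed
  have g_le: "AE p in T \<Otimes>\<^sub>M Q. g p + m (fst p) \<le> f p"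
  proof (rule TQ.AE_pair_measure)
    show "{p \<in> space (T \<Otimes>\<^sub>M Q). g p + m (fst p) \<le> f p} \<in> TQ.events"
      by measurable
    show "AE \<theta> in T. AE x in Q. g (\<theta>, x) + m (fst (\<theta>, x)) \<le> f (\<theta>, x)"
    proof (rule AE_I2)
      fix \<theta> assume "\<theta> \<in> space T"
      from m_le[OF this] show "AE x in Q. g (\<theta>, x) + m (fst (\<theta>, x)) \<le> f (\<theta>, x)"
      proof eventually_elim
        case (elim x)
        have "g (\<theta>, x) + m \<theta> \<le> (f (\<theta>, x) - m \<theta>) + m \<theta>"
          by (intro add_right_mono) (simp add: g_def)
        also have "\<dots> = f (\<theta>, x)"
          by (rule diff_add_cancel_ennreal[OF elim])
        finally show ?case by simp
      qed
    qed
  qed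
  have mJ: "(\<integral>\<^sup>+p. m (fst p) \<partial>J) = (\<integral>\<^sup>+\<theta>. m \<theta> \<partial>T)"
    using nn_integral_distr[of fst J T m] by (simp add: marg)
  have mTQ: "(\<integral>\<^sup>+p. m (fst p) \<partial>(T \<Otimes>\<^sub>M Q)) = (\<integral>\<^sup>+\<theta>. m \<theta> \<partial>T)"
    by (subst Q.nn_integral_fst[symmetric]) (auto simp: Q.emeasure_space_1)
  have "(\<integral>\<^sup>+p. f p \<partial>J) \<le> (\<integral>\<^sup>+p. g p + \<gamma> * m (fst p) \<partial>J)"
    by (intro nn_integral_mono f_le)
  also have "\<dots> = (\<integral>\<^sup>+p. g p \<partial>J) + \<gamma> * (\<integral>\<^sup>+\<theta>. m \<theta> \<partial>T)"
    by (simp add: nn_integral_add nn_integral_cmult mJ)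
  also have "(\<integral>\<^sup>+p. g p \<partial>J) \<le> \<gamma> * (\<integral>\<^sup>+p. g p \<partial>(T \<Otimes>\<^sub>M Q)) + \<eta> * ennreal (E_gamma \<gamma> J (T \<Otimes>\<^sub>M Q))"
    using \<gamma> sets by (intro nn_integral_le_E_gamma J TQ.prob_space_axioms) (auto simp: g_def)
  finally have "(\<integral>\<^sup>+p. f p \<partial>J) \<le> \<gamma> * ((\<integral>\<^sup>+p. g p \<partial>(T \<Otimes>\<^sub>M Q)) + (\<integral>\<^sup>+\<theta>. m \<theta> \<partial>T))
      + \<eta> * ennreal (E_gamma \<gamma> J (T \<Otimes>\<^sub>M Q))"
    by (simp add: distrib_left ac_simps)
  also have "(\<integral>\<^sup>+p. g p \<partial>(T \<Otimes>\<^sub>M Q)) + (\<integral>\<^sup>+\<theta>. m \<theta> \<partial>T) = (\<integral>\<^sup>+p. g p + m (fst p) \<partial>(T \<Otimes>\<^sub>M Q))"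
    by (simp add: nn_integral_add mTQ)
  also have "\<dots> \<le> (\<integral>\<^sup>+p. f p \<partial>(T \<Otimes>\<^sub>M Q))"
    by (rule nn_integral_mono_AE[OF g_le])
  finally show ?thesis
    by (simp add: mult_left_mono add_right_mono)
qed


section \<open>Expected loss of an estimator behind a channel\<close>

lemma measure_le_small_ball:
  assumes "prob_space T" "\<theta> \<in> space T"
  shows "measure T {t \<in> space T. loss t \<theta> \<le> \<zeta>} \<le> small_ball T loss \<zeta>"
  unfolding small_ball_def using assms
  by (intro cSUP_upper bdd_aboveI2[where M=1]) (auto intro: prob_space.prob_le_1)

text \<open>Stated for an arbitrary channel so that it yields both risk bounds: \<open>K\<close> may
  act on whole samples with the constant \<open>phi n \<epsilon> \<delta>\<close>, or on a single
  observation with the constant \<delta>.\<close>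

lemma expected_loss_bound:
  fixes \<gamma> \<eta> \<zeta> :: real
  assumes T: "prob_space T" and \<kappa>: "\<kappa> \<in> T \<rightarrow>\<^sub>M prob_algebra M" and K: "K \<in> M \<rightarrow>\<^sub>M prob_algebra N"
    and \<gamma>: "1 \<le> \<gamma>" and \<eta>: "0 \<le> \<eta>"
    and le: "\<And>x y A. x \<in> space M \<Longrightarrow> y \<in> space M \<Longrightarrow> A \<in> sets N \<Longrightarrow>
      measure (K x) A \<le> \<eta> + \<gamma> * measure (K y) A"
    and loss: "(\<lambda>(s, t). loss s t) \<in> borel_measurable (T \<Otimes>\<^sub>M T)"
    and \<Psi>[measurable]: "\<Psi> \<in> N \<rightarrow>\<^sub>M T" and \<zeta>: "0 < \<zeta>"
  shows "ennreal (\<zeta> * (1 - \<eta> * E_gamma_information \<gamma> T M (joint_law T M \<kappa>) - \<gamma> * small_ball T loss \<zeta>))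
    \<le> (\<integral>\<^sup>+(\<theta>, z). ennreal (loss \<theta> (\<Psi> z)) \<partial>joint_law T N (\<lambda>\<theta>. Giry_Monad.bind (\<kappa> \<theta>) K))"
proof -
  interpret T: prob_space T by fact
  define J where "J = joint_law T M \<kappa>"
  define Q where "Q = distr J M snd"
  define JZ where "JZ = joint_law T N (\<lambda>\<theta>. Giry_Monad.bind (\<kappa> \<theta>) K)"
  have \<kappa>K: "(\<lambda>\<theta>. Giry_Monad.bind (\<kappa> \<theta>) K) \<in> T \<rightarrow>\<^sub>M prob_algebra N"
    by (rule measurable_bind_prob_space[OF \<kappa> K])
  have J: "prob_space J" "sets J = sets (T \<Otimes>\<^sub>M M)" and JZ: "prob_space JZ" "sets JZ = sets (T \<Otimes>\<^sub>M N)"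
    using joint_law_in_prob_algebra[OF T \<kappa>] joint_law_in_prob_algebra[OF T \<kappa>K]
    by (auto simp: J_def JZ_def space_prob_algebra)
  interpret J: prob_space J by (rule J)
  interpret JZ: prob_space JZ by (rule JZ)
  note [measurable_cong] = J(2) JZ(2)
  interpret Q: prob_space Q
    unfolding Q_def by (rule J.prob_space_distr) measurable
  have Q_sets[measurable_cong]: "sets Q = sets M" and Q_space: "space Q = space M" by (auto simp: Q_def)
  interpret TQ: pair_prob_space T Q ..
  have sTQ: "sets (T \<Otimes>\<^sub>M Q) = sets (T \<Otimes>\<^sub>M M)" by (intro sets_pair_measure_cong refl Q_sets)
  have marg: "distr J T fst = T" unfolding J_def by (rule distr_joint_law_fst[OF T \<kappa>])
  have loss'[measurable]: "(\<lambda>p. loss (fst p) (\<Psi> (snd p))) \<in> borel_measurable (T \<Otimes>\<^sub>M N)"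
    using measurable_compose[OF _ loss, of "\<lambda>p. (fst p, \<Psi> (snd p))" "T \<Otimes>\<^sub>M N"] by simp
  define A where "A = {p \<in> space (T \<Otimes>\<^sub>M N). loss (fst p) (\<Psi> (snd p)) \<le> \<zeta>}"
  have A[measurable]: "A \<in> sets (T \<Otimes>\<^sub>M N)" unfolding A_def by measurable
  have K': "prob_space (K x)" "sets (K x) = sets N" if "x \<in> space M" for x
    using measurable_space[OF K that] by (auto simp: space_prob_algebra)
  \<comment> \<open>\<open>f (\<theta>, x)\<close> is the conditional probability of
    \<open>A\<close> given the parameter and the channel input. Averaging over the channel first
    moves the problem from the output to the input, so the contraction step involves only the
    information of the input.\<close>
  define f where "f p = (\<integral>\<^sup>+z. indicator A (fst p, z) \<partial>K (snd p))" for p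
  have f[measurable]: "f \<in> borel_measurable (T \<Otimes>\<^sub>M M)"
    unfolding f_def
    by (rule nn_integral_measurable_subprob_algebra2[where N=N])
      (use measurable_prob_algebraD[OF K] in measurable)
  have f_eq: "f (\<theta>, x) = ennreal (measure (K x) (Pair \<theta> -` A))" and
    A_sec: "Pair \<theta> -` A \<in> sets N" if "x \<in> space M" for \<theta> x
  proof -
    interpret Kx: prob_space "K x" by (rule K'(1)[OF that])
    show S: "Pair \<theta> -` A \<in> sets N" by (rule sets_Pair1[OF A])
    have "f (\<theta>, x) = (\<integral>\<^sup>+z. indicator (Pair \<theta> -` A) z \<partial>K x)"
      by (simp add: f_def indicator_def)
    then show "f (\<theta>, x) = ennreal (measure (K x) (Pair \<theta> -` A))"
      using S K'(2)[OF that] by (simp add: Kx.emeasure_eq_measure)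
  qed
  define L where "L = small_ball T loss \<zeta>"
  define E where "E = E_gamma \<gamma> J (T \<Otimes>\<^sub>M Q)"
  have "0 \<le> E"
    using measure_diff_le_E_gamma[OF J(1) TQ.prob_space_axioms, of \<gamma> "{}"] \<gamma> by (simp add: E_def)
  obtain \<theta>0 where "\<theta>0 \<in> space T" using T.not_empty by auto
  then have "0 \<le> L"
    using measure_le_small_ball[OF T, of \<theta>0 loss \<zeta>] by (simp add: L_def order_trans[OF measure_nonneg])
  have "emeasure JZ A = (\<integral>\<^sup>+p. indicator A p \<partial>JZ)"
    by simp
  also have "\<dots> = (\<integral>\<^sup>+\<theta>. \<integral>\<^sup>+z. indicator A (\<theta>, z) \<partial>(Giry_Monad.bind (\<kappa> \<theta>) K) \<partial>T)"
    unfolding JZ_def by (rule nn_integral_joint_law[OF \<kappa>K]) measurable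
  also have "\<dots> = (\<integral>\<^sup>+\<theta>. \<integral>\<^sup>+x. f (\<theta>, x) \<partial>\<kappa> \<theta> \<partial>T)"
  proof (rule nn_integral_cong)
    fix \<theta> assume \<theta>[measurable]: "\<theta> \<in> space T"
    have "sets (\<kappa> \<theta>) = sets M"
      using measurable_space[OF \<kappa> \<theta>] by (simp add: space_prob_algebra)
    then have "K \<in> \<kappa> \<theta> \<rightarrow>\<^sub>M subprob_algebra N"
      using measurable_prob_algebraD[OF K] by (simp cong: measurable_cong_sets)
    then show "(\<integral>\<^sup>+z. indicator A (\<theta>, z) \<partial>(Giry_Monad.bind (\<kappa> \<theta>) K)) = (\<integral>\<^sup>+x. f (\<theta>, x) \<partial>\<kappa> \<theta>)"
      unfolding f_def by (subst nn_integral_bind[where B=N]) auto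
  qed
  also have "\<dots> = (\<integral>\<^sup>+p. f p \<partial>J)"
    unfolding J_def by (rule nn_integral_joint_law[OF \<kappa> f, symmetric])
  also have "\<dots> \<le> \<gamma> * (\<integral>\<^sup>+p. f p \<partial>(T \<Otimes>\<^sub>M Q)) + \<eta> * ennreal E"
    unfolding E_def
  proof (rule nn_integral_contraction[OF T Q.prob_space_axioms J(1) _ marg \<gamma> \<eta>])
    show "sets J = sets (T \<Otimes>\<^sub>M Q)" using J(2) sTQ by simp
    show "f \<in> borel_measurable (T \<Otimes>\<^sub>M Q)" by measurable
    show "f (\<theta>, x) \<le> \<eta> + \<gamma> * f (\<theta>, y)" if "x \<in> space Q" "y \<in> space Q" for \<theta> x y
    proof -
      have xy: "x \<in> space M" "y \<in> space M" using that by (auto simp: Q_space)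
      show ?thesis
        using ennreal_leI[OF le[OF xy A_sec[OF xy(1), of \<theta>]]] \<eta> \<gamma>
        by (simp add: f_eq xy ennreal_mult)
    qed
  qed
  \<comment> \<open>Under the product of the marginals the parameter is independent of the output.
    Integrating over \<theta> first, with the output \<open>z\<close> fixed, leaves the probability
    of a ball around \<open>\<Psi> z\<close>.\<close>
  also have "(\<integral>\<^sup>+p. f p \<partial>(T \<Otimes>\<^sub>M Q)) = (\<integral>\<^sup>+x. \<integral>\<^sup>+\<theta>. f (\<theta>, x) \<partial>T \<partial>Q)"
    by (rule TQ.nn_integral_snd[symmetric]) measurable
  also have "\<dots> \<le> (\<integral>\<^sup>+x. L \<partial>Q)"
  proof (rule nn_integral_mono)
    fix x assume "x \<in> space Q"
    then have x: "x \<in> space M" by (simp add: Q_space)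
    interpret Kx: prob_space "K x" by (rule K'(1)[OF x])
    note [measurable_cong] = K'(2)[OF x]
    interpret TK: pair_prob_space T "K x" ..
    have "(\<integral>\<^sup>+\<theta>. f (\<theta>, x) \<partial>T) = (\<integral>\<^sup>+z. \<integral>\<^sup>+\<theta>. indicator A (\<theta>, z) \<partial>T \<partial>K x)"
      unfolding f_def fst_conv snd_conv by (rule TK.Fubini'[symmetric]) measurable
    also have "\<dots> \<le> (\<integral>\<^sup>+z. L \<partial>K x)"
    proof (rule nn_integral_mono)
      fix z assume "z \<in> space (K x)"
      then have z[measurable]: "z \<in> space N" using sets_eq_imp_space_eq[OF K'(2)[OF x]] by simp
      let ?S = "{t \<in> space T. loss t (\<Psi> z) \<le> \<zeta>}"
      have S: "?S = (\<lambda>\<theta>. (\<theta>, z)) -` A \<inter> space T"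
        using z by (auto simp: A_def space_pair_measure)
      have "(\<integral>\<^sup>+\<theta>. indicator A (\<theta>, z) \<partial>T) = (\<integral>\<^sup>+\<theta>. indicator ?S \<theta> \<partial>T)"
        unfolding S by (intro nn_integral_cong) (auto split: split_indicator)
      also have "\<dots> = emeasure T ?S"
        unfolding S by (intro nn_integral_indicator) measurable
      finally show "(\<integral>\<^sup>+\<theta>. indicator A (\<theta>, z) \<partial>T) \<le> ennreal L"
        using measure_le_small_ball[OF T measurable_space[OF \<Psi> z]]
        by (simp add: T.emeasure_eq_measure L_def ennreal_leI)
    qed
    finally show "(\<integral>\<^sup>+\<theta>. f (\<theta>, x) \<partial>T) \<le> ennreal L"
      by (simp add: Kx.emeasure_space_1)
  qed
  finally have "ennreal (measure JZ A) \<le> ennreal (\<gamma> * L + \<eta> * E)"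
    using \<open>0 \<le> L\<close> \<open>0 \<le> E\<close> \<eta> \<gamma>
    by (simp add: Q.emeasure_space_1 JZ.emeasure_eq_measure ennreal_mult mult_left_mono add_right_mono)
  then have bound: "measure JZ A \<le> \<gamma> * L + \<eta> * E"
    using \<open>0 \<le> L\<close> \<open>0 \<le> E\<close> \<eta> \<gamma> by (subst (asm) ennreal_le_iff) auto
  \<comment> \<open>Off \<open>A\<close> the loss exceeds \<zeta>, so \<zeta> times the probability
    of the complement bounds the expected loss from below.\<close>
  have "\<zeta> * (1 - \<eta> * E - \<gamma> * L) \<le> \<zeta> * measure JZ (space JZ - A)"
    using bound \<zeta> by (intro mult_left_mono) (auto simp: JZ.prob_compl)
  then have "ennreal (\<zeta> * (1 - \<eta> * E - \<gamma> * L)) \<le> ennreal \<zeta> * emeasure JZ (space JZ - A)"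
    using \<zeta> by (metis JZ.emeasure_eq_measure ennreal_leI ennreal_mult' less_imp_le)
  also have "\<dots> = (\<integral>\<^sup>+p. ennreal \<zeta> * indicator (space JZ - A) p \<partial>JZ)"
    by (simp add: nn_integral_cmult_indicator)
  also have "\<dots> \<le> (\<integral>\<^sup>+(\<theta>, z). ennreal (loss \<theta> (\<Psi> z)) \<partial>JZ)"
    using sets_eq_imp_space_eq[OF JZ(2)]
    by (intro nn_integral_mono) (auto simp: A_def not_le intro!: ennreal_leI split: split_indicator)
  finally show ?thesis
    by (simp add: E_def L_def J_def JZ_def Q_def E_gamma_information_def marg[unfolded J_def])
qed

section \<open>Consequences of local differential privacy\<close>

lemma LDP_kernelsD:
  assumes K: "K \<in> LDP_kernels X Z \<epsilon> \<delta>" and "x \<in> space X" "y \<in> space X" "A \<in> sets Z"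
  shows "measure (K x) A \<le> \<delta> + exp \<epsilon> * measure (K y) A"
proof -
  have "ereal (measure (K x) A - exp \<epsilon> * measure (K y) A) \<le>
      (SUP x1\<in>space X. SUP x2\<in>space X. SUP A\<in>sets Z. ereal (measure (K x1) A - exp \<epsilon> * measure (K x2) A))"
    using assms by (intro SUP_upper2[of x] SUP_upper2[of y] SUP_upper2[of A] order_refl)
  also have "\<dots> \<le> ereal \<delta>"
    using K by (simp add: LDP_kernels_def)
  finally show ?thesis by simp
qed

text \<open>Composing the privacy inequality over the coordinates would raise the factor to
  \<open>exp (n * \<epsilon>)\<close>. Overlaps avoid this: one use of \<open>K\<close> overlaps in
  mass at least \<open>c\<close>, hence \<open>n\<close> uses in at least \<open>c ^ n\<close>,
  which is \<open>1 - phi n \<epsilon> \<delta>\<close>.\<close>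

lemma power_kernel_LDP:
  assumes \<epsilon>: "0 \<le> \<epsilon>" and \<delta>: "0 \<le> \<delta>" "\<delta> \<le> 1" and n: "1 \<le> n"
    and K: "K \<in> LDP_kernels X Z \<epsilon> \<delta>"
    and x: "x \<in> space (power_space n X)" and y: "y \<in> space (power_space n X)"
    and A: "A \<in> sets (power_space n Z)"
  shows "measure (power_kernel n K x) A \<le> phi n \<epsilon> \<delta> + exp \<epsilon> * measure (power_kernel n K y) A"
proof -
  have Km: "K \<in> X \<rightarrow>\<^sub>M prob_algebra Z" using K by (simp add: LDP_kernels_def)
  have K': "prob_space (K a)" "sets (K a) = sets Z" if "a \<in> space X" for a
    using measurable_space[OF Km that] by (auto simp: space_prob_algebra)
  have pow: "prob_space (power_kernel n K a)" "sets (power_kernel n K a) = sets (power_space n Z)"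
    if "a \<in> space (power_space n X)" for a
    using measurable_space[OF measurable_power_kernel[OF n Km] that] by (auto simp: space_prob_algebra)
  let ?x = "\<lambda>i. x (if i < n then i else 0)" and ?y = "\<lambda>i. y (if i < n then i else 0)"
  have xy: "?x i \<in> space X" "?y i \<in> space X" for i
    using n by (auto intro!: PiE_mem[OF x[unfolded space_PiM]] PiE_mem[OF y[unfolded space_PiM]])
  define c where "c = exp (- \<epsilon>) * (1 - \<delta>)"
  have c0: "0 \<le> c" using \<delta> by (simp add: c_def)
  have step: "ennreal c \<le> emeasure (K (?x i)) B + emeasure (K (?y i)) (space (K (?x i)) - B)"
    if B: "B \<in> sets (K (?x i))" for i B
  proof -
    interpret x: prob_space "K (?x i)" by (rule K'(1)[OF xy(1)])
    interpret y: prob_space "K (?y i)" by (rule K'(1)[OF xy(2)])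
    have s: "sets (K (?x i)) = sets Z" "sets (K (?y i)) = sets Z" by (rule K'(2)[OF xy(1)] K'(2)[OF xy(2)])+
    have sp: "space (K (?x i)) = space (K (?y i))" by (rule sets_eq_imp_space_eq) (simp only: s)
    \<comment> \<open>Privacy is applied with the two inputs exchanged; the left side is the mass of
      \<open>B\<close> under \<open>K (?y i)\<close>.\<close>
    have "1 - measure (K (?y i)) (space (K (?x i)) - B) \<le> \<delta> + exp \<epsilon> * measure (K (?x i)) B"
      using LDP_kernelsD[OF K xy(2,1), of B i i] B s y.prob_compl[of B] unfolding sp by simp
    then have "exp (- \<epsilon>) * (1 - \<delta>) \<le>
        exp (- \<epsilon>) * (exp \<epsilon> * measure (K (?x i)) B + measure (K (?y i)) (space (K (?x i)) - B))"
      by (intro mult_left_mono) auto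
    also have "\<dots> = measure (K (?x i)) B + exp (- \<epsilon>) * measure (K (?y i)) (space (K (?x i)) - B)"
      by (simp add: distrib_left exp_minus)
    also have "\<dots> \<le> measure (K (?x i)) B + measure (K (?y i)) (space (K (?x i)) - B)"
      using \<epsilon> by (intro add_left_mono mult_left_le_one_le) auto
    finally show ?thesis
      by (simp add: c_def x.emeasure_eq_measure y.emeasure_eq_measure ennreal_leI flip: ennreal_plus)
  qed
  interpret px: prob_space "power_kernel n K x" by (rule pow(1)[OF x])
  interpret py: prob_space "power_kernel n K y" by (rule pow(1)[OF y])
  have A': "A \<in> sets (power_kernel n K x)" "A \<in> sets (power_kernel n K y)"
    using A pow(2)[OF x] pow(2)[OF y] by simp_all
  \<comment> \<open>The functions are the indicators of the complement of \<open>A\<close> and of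
    \<open>A\<close>; they add up to 1, so \<open>w\<close> is 1.\<close>
  have "ennreal c ^ card {..<n} * 1 \<le>
     (\<integral>\<^sup>+z. indicator (space (power_kernel n K x) - A) z \<partial>power_kernel n K x) +
     (\<integral>\<^sup>+z. indicator A z \<partial>power_kernel n K y)"
    using A' unfolding power_kernel_eq[OF n]
    by (intro overlap_nn_integral_PiM step K'(1) xy)
      (auto simp: K'(2)[OF xy(1)] K'(2)[OF xy(2)] split: split_indicator)
  also have "\<dots> = ennreal (measure (power_kernel n K x) (space (power_kernel n K x) - A) + measure (power_kernel n K y) A)"
    using A' by (simp add: px.emeasure_eq_measure py.emeasure_eq_measure)
  finally have "c ^ n \<le> 1 - measure (power_kernel n K x) A + measure (power_kernel n K y) A"
    using c0 A' by (simp add: ennreal_power px.prob_compl flip: ennreal_plus)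
  moreover have "c ^ n = exp (- (real n * \<epsilon>)) * (1 - \<delta>) ^ n"
    by (simp add: c_def power_mult_distrib exp_of_nat_mult[symmetric])
  moreover have "measure (power_kernel n K y) A \<le> exp \<epsilon> * measure (power_kernel n K y) A"
    using \<epsilon> by (simp add: mult_le_cancel_right1)
  ultimately show ?thesis by (simp add: phi_def)
qed

lemma phi_nonneg:
  assumes "0 \<le> \<epsilon>" "0 \<le> \<delta>" "\<delta> \<le> 1"
  shows "0 \<le> phi n \<epsilon> \<delta>"
  using assms mult_mono[of "exp (- (real n * \<epsilon>))" 1 "(1 - \<delta>) ^ n" 1]
  by (simp add: phi_def power_le_one)

section \<open>Samples of size one\<close>

lemma measurable_singleton_tuple: "(\<lambda>z. \<lambda>i\<in>{..<1}. z) \<in> N \<rightarrow>\<^sub>M power_space 1 N"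
  by (rule measurable_restrict) auto

lemma power_space_one:
  assumes "prob_space N" "sets N = sets M"
  shows "power_space 1 N = distr N (power_space 1 M) (\<lambda>z. \<lambda>i\<in>{..<1}. z)"
proof -
  interpret product_prob_space "\<lambda>_::nat. N" by (rule product_prob_spaceI) fact
  have "power_space 1 N = distr N (power_space 1 N) (\<lambda>z. \<lambda>i\<in>{..<1}. z)"
    using distr_component[of 0] by (simp add: lessThan_Suc)
  also have "\<dots> = distr N (power_space 1 M) (\<lambda>z. \<lambda>i\<in>{..<1}. z)"
    by (intro distr_cong refl sets_PiM_cong assms(2))
  finally show ?thesis .
qed

text \<open>Identifies a point with its 1-tuple on the input side only: sampling then takes place on
  \<open>X\<close> itself, as the information term for one observation requires, while outputs stay
  1-tuples, as the estimators require.\<close>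

lemma private_law_one:
  assumes P: "prob_space (P \<theta>)" "sets (P \<theta>) = sets X" and K: "K \<in> X \<rightarrow>\<^sub>M prob_algebra Z"
  shows "private_law 1 P K \<theta> =
    Giry_Monad.bind (P \<theta>) (\<lambda>a. distr (K a) (power_space 1 Z) (\<lambda>z. \<lambda>i\<in>{..<1}. z))"
proof -
  let ?t = "\<lambda>z. \<lambda>i\<in>{..<1::nat}. z"
  have sp: "space (P \<theta>) = space X" by (rule sets_eq_imp_space_eq[OF P(2)])
  have t: "?t \<in> P \<theta> \<rightarrow>\<^sub>M power_space 1 X"
    using measurable_singleton_tuple[of X] P(2) by (simp cong: measurable_cong_sets)
  have "private_law 1 P K \<theta> = Giry_Monad.bind (distr (P \<theta>) (power_space 1 X) ?t) (power_kernel 1 K)"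
    unfolding private_law_def sample_law_def power_space_one[OF P] ..
  also have "\<dots> = Giry_Monad.bind (P \<theta>) (\<lambda>a. power_kernel 1 K (?t a))"
    by (rule bind_distr[OF t measurable_prob_algebraD[OF measurable_power_kernel[OF order_refl K]]
        prob_space.not_empty[OF P(1)]])
  also have "\<dots> = Giry_Monad.bind (P \<theta>) (\<lambda>a. distr (K a) (power_space 1 Z) ?t)"
  proof (rule bind_cong[OF refl])
    fix a assume "a \<in> space (P \<theta>)"
    then have a: "prob_space (K a)" "sets (K a) = sets Z"
      using measurable_space[OF K, of a] by (auto simp: sp space_prob_algebra)
    have "power_kernel 1 K (?t a) = power_space 1 (K a)"
      unfolding power_kernel_def by (intro PiM_cong) auto
    then show "power_kernel 1 K (?t a) = distr (K a) (power_space 1 Z) ?t"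
      using power_space_one[OF a] by simp
  qed
  finally show ?thesis .
qed

section \<open>The risk bounds for every kernel and estimator\<close>

text \<open>The bracket in the bounds may be negative. \<open>ennreal\<close> then truncates it to
  0, and the inequality in \<open>ereal\<close> holds because \<open>enn2ereal\<close> is
  nonnegative.\<close>

lemma ereal_le_enn2ereal:
  assumes "ennreal r \<le> x"
  shows "ereal r \<le> enn2ereal x"
  using assms by (cases "0 \<le> r")
    (auto simp: less_eq_ennreal.rep_eq intro: order_trans[OF _ enn2ereal_nonneg])

theorem theorem4:
  fixes T :: "'t measure" and X :: "'x measure" and Z :: "'z measure"
    and P :: "'t \<Rightarrow> 'x measure" and loss :: "'t \<Rightarrow> 't \<Rightarrow> real"
    and \<epsilon> \<delta> :: real and n :: nat
  assumes "0 \<le> \<epsilon>" and "0 \<le> \<delta>" and "\<delta> \<le> 1" and "1 \<le> n"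
    and "prob_space T"
    and "P \<in> T \<rightarrow>\<^sub>M prob_algebra X"
    and "(\<lambda>(s, t). loss s t) \<in> borel_measurable (T \<Otimes>\<^sub>M T)"
    and "\<And>s t. s \<in> space T \<Longrightarrow> t \<in> space T \<Longrightarrow> 0 \<le> loss s t"
  shows "(SUP \<zeta>\<in>{0<..}. ereal (\<zeta> *
            (1 - phi n \<epsilon> \<delta> *
                   E_gamma_information (exp \<epsilon>) T (power_space n X)
                     (joint_law T (power_space n X) (sample_law n P))
               - exp \<epsilon> * small_ball T loss \<zeta>)))
           \<le> enn2ereal (private_bayes_risk n T X P Z loss \<epsilon> \<delta>)
       \<and> (SUP \<zeta>\<in>{0<..}. ereal (\<zeta> *
            (1 - \<delta> * E_gamma_information (exp \<epsilon>) T X (joint_law T X P)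
               - exp \<epsilon> * small_ball T loss \<zeta>)))
           \<le> enn2ereal (private_bayes_risk 1 T X P Z loss \<epsilon> \<delta>)"
proof (intro conjI SUP_least ereal_le_enn2ereal; unfold private_bayes_risk_def; intro INF_greatest)
  fix \<zeta> K \<Psi> assume \<zeta>: "\<zeta> \<in> {0::real<..}" and K: "K \<in> LDP_kernels X Z \<epsilon> \<delta>"
    and \<Psi>: "\<Psi> \<in> power_space n Z \<rightarrow>\<^sub>M T"
  have Km: "K \<in> X \<rightarrow>\<^sub>M prob_algebra Z" using K by (simp add: LDP_kernels_def)
  show "ennreal (\<zeta> * (1 - phi n \<epsilon> \<delta> *
                   E_gamma_information (exp \<epsilon>) T (power_space n X)
                     (joint_law T (power_space n X) (sample_law n P))
               - exp \<epsilon> * small_ball T loss \<zeta>))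
     \<le> (\<integral>\<^sup>+(\<theta>, z). ennreal (loss \<theta> (\<Psi> z)) \<partial>joint_law T (power_space n Z) (private_law n P K))"
    \<comment> \<open>This exposes \<open>power_kernel n K\<close> as a channel applied to the whole
      sample.\<close>
    unfolding private_law_def
    using assms \<zeta> \<Psi>
    by (intro expected_loss_bound measurable_sample_law measurable_power_kernel Km phi_nonneg
        power_kernel_LDP[OF _ _ _ _ K]) auto
next
  fix \<zeta> K \<Psi> assume \<zeta>: "\<zeta> \<in> {0::real<..}" and K: "K \<in> LDP_kernels X Z \<epsilon> \<delta>"
    and \<Psi>: "\<Psi> \<in> power_space 1 Z \<rightarrow>\<^sub>M T"
  have Km: "K \<in> X \<rightarrow>\<^sub>M prob_algebra Z" using K by (simp add: LDP_kernels_def)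
  \<comment> \<open>Taking the first bound at \<open>n = 1\<close> would give
    \<open>phi 1 \<epsilon> \<delta>\<close>, which is at least \<delta>. With \<open>?K\<close> as
    a channel on single observations, the privacy inequality itself serves as the hypothesis, with
    constant \<delta>.\<close>
  let ?K = "\<lambda>a. distr (K a) (power_space 1 Z) (\<lambda>z. \<lambda>i\<in>{..<1}. z)"
  have K': "?K \<in> X \<rightarrow>\<^sub>M prob_algebra (power_space 1 Z)"
    by (rule measurable_compose[OF Km measurable_distr_prob_space[OF measurable_singleton_tuple]])
  have "joint_law T (power_space 1 Z) (private_law 1 P K) =
      joint_law T (power_space 1 Z) (\<lambda>\<theta>. Giry_Monad.bind (P \<theta>) ?K)"
    unfolding joint_law_def using measurable_space[OF assms(6)]
    by (intro bind_cong refl) (auto simp: private_law_one[OF _ _ Km] space_prob_algebra simp del: One_nat_def)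
  moreover have "ennreal (\<zeta> * (1 - \<delta> * E_gamma_information (exp \<epsilon>) T X (joint_law T X P)
               - exp \<epsilon> * small_ball T loss \<zeta>))
     \<le> (\<integral>\<^sup>+(\<theta>, z). ennreal (loss \<theta> (\<Psi> z)) \<partial>joint_law T (power_space 1 Z) (\<lambda>\<theta>. Giry_Monad.bind (P \<theta>) ?K))"
  proof (rule expected_loss_bound[OF _ _ K' _ _ _ _ \<Psi>])
    fix x y A assume xy: "x \<in> space X" "y \<in> space X" and A: "A \<in> sets (power_space 1 Z)"
    \<comment> \<open>Events on 1-tuples pull back to events on \<open>Z\<close>, so the privacy
      inequality passes from \<open>K\<close> to \<open>?K\<close>.\<close>
    let ?B = "(\<lambda>z. \<lambda>i\<in>{..<1::nat}. z) -` A \<inter> space Z"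
    have B: "?B \<in> sets Z" by (rule measurable_sets[OF measurable_singleton_tuple A])
    have "measure (?K a) A = measure (K a) ?B" if "a \<in> space X" for a
    proof -
      have s: "sets (K a) = sets Z" using measurable_space[OF Km that] by (simp add: space_prob_algebra)
      have "(\<lambda>z. \<lambda>i\<in>{..<1::nat}. z) \<in> K a \<rightarrow>\<^sub>M power_space 1 Z"
        using measurable_singleton_tuple[of Z] s by (simp cong: measurable_cong_sets)
      from measure_distr[OF this A] show ?thesis
        by (simp add: sets_eq_imp_space_eq[OF s])
    qed
    then show "measure (?K x) A \<le> \<delta> + exp \<epsilon> * measure (?K y) A"
      using LDP_kernelsD[OF K xy B] xy by simp
  qed (use assms \<zeta> in auto)
  ultimately show "ennreal (\<zeta> * (1 - \<delta> * E_gamma_information (exp \<epsilon>) T X (joint_law T X P)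
               - exp \<epsilon> * small_ball T loss \<zeta>))
     \<le> (\<integral>\<^sup>+(\<theta>, z). ennreal (loss \<theta> (\<Psi> z)) \<partial>joint_law T (power_space 1 Z) (private_law 1 P K))"
    by simp
qed

end
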